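(* Let $D$ be a finite simple directed acyclic graph. The acyclic reorientation poset $\mathcal{AR}_D$ is a lattice if and only if $D$ is vertebrate.
   Context: Let $D=(V,A)$ be a finite simple directed acyclic graph (no loops, at most one arc between two vertices). A reorientation of $D$ is a directed graph with the same underlying undirected graph as $D$; it is encoded by the set of arcs of $D$ that it reverses. The acyclic reorientation poset $\mathcal{AR}_D$ is the set of acyclic reorientations of $D$ (those with no directed cycle), ordered by inclusion of their sets of reversed arcs. The transitive reduction of a directed acyclic graph is the directed graph obtained by deleting all arcs whose endpoints are connected by a directed path of length at least $2$. A directed graph is called a forest if its underlying undirected graph has no cycle. $D$ is vertebrate if, for every $U\subseteq V$, the transitive reduction of the subgraph of $D$ induced by $U$ is a forest. *)

theory Defs
  imports
    "Graph_Theory.Digraph_Component"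
    "HOL-Algebra.Lattice"
begin

text \<open>
  The asymmetry of the arc relation says that two vertices are joined by at most one arc.
\<close>

locale simple_dag = pair_digraph D for D :: "'a pair_pre_digraph" +
  assumes asym_arcs: "asym (parcs D)"
    and no_cycle: "\<not> (\<exists>p. cycle p)"

text \<open>
  The underlying undirected graph of a digraph is represented by its symmetric closure
  \<^const>\<open>mk_symmetric\<close>. A reorientation picks exactly one of the two directions of each edge,
  so its arc relation is asymmetric again.
\<close>

definition reorientation :: "'a pair_pre_digraph \<Rightarrow> 'a pair_pre_digraph \<Rightarrow> bool" where
  "reorientation D E \<longleftrightarrow> mk_symmetric E = mk_symmetric D \<and> asym (parcs E)"

definition reversed_arcs :: "'a pair_pre_digraph \<Rightarrow> 'a pair_pre_digraph \<Rightarrow> 'a rel" where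
  "reversed_arcs D E = {(u, v) \<in> parcs D. (v, u) \<in> parcs E}"

definition acyclic_reorientation_poset ::
    "'a pair_pre_digraph \<Rightarrow> 'a pair_pre_digraph gorder" where
  "acyclic_reorientation_poset D =
    \<lparr> carrier = {E. reorientation D E \<and> \<not> (\<exists>p. pre_digraph.cycle E p)},
      eq = (=),
      le = (\<lambda>E F. reversed_arcs D E \<subseteq> reversed_arcs D F) \<rparr>"

definition transitive_reduction :: "('a, 'b) pre_digraph \<Rightarrow> ('a, 'b) pre_digraph" where
  "transitive_reduction G =
    G \<lparr> arcs := {e \<in> arcs G.
         \<not> (\<exists>p. pre_digraph.apath G (tail G e) p (head G e) \<and> 2 \<le> length p)} \<rparr>"

text \<open>
  In the symmetric closure every edge gives a directed cycle of length 2, which is not a cycle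
  of the undirected graph; the undirected cycles are the ones of length at least 3. (The constant
  \<^const>\<open>forest\<close> of the library only excludes directed cycles.) Parallel arcs are identified by
  \<^const>\<open>mk_symmetric\<close>, so the definition is meant for digraphs without loops in which any two
  vertices are joined by at most one arc.
\<close>

definition underlying_forest :: "('a, 'b) pre_digraph \<Rightarrow> bool" where
  "underlying_forest G \<longleftrightarrow>
    \<not> (\<exists>p. pre_digraph.cycle (mk_symmetric G) p \<and> 3 \<le> length p)"

definition vertebrate :: "'a pair_pre_digraph \<Rightarrow> bool" where
  "vertebrate D \<longleftrightarrow>
    (\<forall>U \<subseteq> pverts D. underlying_forest (transitive_reduction (with_proj D \<restriction> U)))"

lemma reorientation_eqI:
  assumes E: "reorientation D E" and F: "reorientation D F"
    and eq: "reversed_arcs D E = reversed_arcs D F"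
  shows "E = F"
proof -
  have sub: "parcs E \<subseteq> parcs F"
    if E: "reorientation D E" and F: "reorientation D F"
      and eq: "reversed_arcs D E = reversed_arcs D F" for E F
  proof
    fix a assume a: "a \<in> parcs E"
    obtain u v where uv: "a = (u, v)" by (cases a)
    have symE: "(x, y) \<in> parcs E \<or> (y, x) \<in> parcs E \<longleftrightarrow> (x, y) \<in> parcs D \<or> (y, x) \<in> parcs D"
      and symF: "(x, y) \<in> parcs F \<or> (y, x) \<in> parcs F \<longleftrightarrow> (x, y) \<in> parcs D \<or> (y, x) \<in> parcs D"
      for x y
    proof -
      have *: "(x, y) \<in> parcs (mk_symmetric (with_proj G)) \<longleftrightarrow> (x, y) \<in> parcs G \<or> (y, x) \<in> parcs G"
        for G :: "'a pair_pre_digraph"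
        by (auto simp: parcs_mk_symmetric prod_eq_iff Bex_def)
      show "(x, y) \<in> parcs E \<or> (y, x) \<in> parcs E \<longleftrightarrow> (x, y) \<in> parcs D \<or> (y, x) \<in> parcs D"
        using E *[of E] *[of D] by (simp add: reorientation_def)
      show "(x, y) \<in> parcs F \<or> (y, x) \<in> parcs F \<longleftrightarrow> (x, y) \<in> parcs D \<or> (y, x) \<in> parcs D"
        using F *[of F] *[of D] by (simp add: reorientation_def)
    qed
    have asE: "(v, u) \<notin> parcs E" using E a uv by (auto simp: reorientation_def dest: asymD)
    have r: "(x, y) \<in> parcs D \<and> (y, x) \<in> parcs E \<longleftrightarrow> (x, y) \<in> parcs D \<and> (y, x) \<in> parcs F" for x y
      using eq by (auto simp: reversed_arcs_def)
    show "a \<in> parcs F"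
      using symE[of u v] symF[of u v] r[of u v] r[of v u] a asE uv by auto
  qed
  have "parcs E = parcs F"
    using sub[OF E F eq] sub[OF F E eq[symmetric]] by blast
  moreover have "pverts E = pverts F"
    using E F by (metis pverts_mk_symmetric reorientation_def with_proj_simps(1))
  ultimately show ?thesis by simp
qed

lemma partial_order_acyclic_reorientation_poset:
  "partial_order (acyclic_reorientation_poset D)"
  by unfold_locales (auto simp: acyclic_reorientation_poset_def intro: reorientation_eqI)

end

theory Submission
  imports Defs
begin

text \<open>
  If the transitive reduction of an induced subgraph contains an undirected cycle \<open>C\<close>, the join of
  the reversals of the single arcs traversed forwards by \<open>C\<close> would have to reverse exactly these
  arcs of \<open>C\<close>, since it lies below every reversal of all arcs but one backward arc; but then \<open>C\<close>
  becomes directed.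

  Conversely, suppose that \<open>D\<close> is vertebrate. An induced cycle of \<open>D\<close> then consists of an arc and a
  parallel directed path, so reversing a set \<open>S\<close> of arcs leaves \<open>D\<close> acyclic iff \<open>S\<close> and its
  complement both contain every arc that they span by a directed path. The join of \<open>S\<close> and \<open>T\<close> is
  the set of arcs spanned by paths in \<open>S \<union> T\<close>, and meets follow by complementation.
\<close>

section \<open>Acyclic sets of reversals\<close>

text \<open>For acyclic \<open>R\<close> these are the cover relations of the order generated by
  \<open>R\<close>, that is, the arcs of the transitive reduction: \<open>R O R\<^sup>+\<close>
  joins the ends of paths with at least two arcs.\<close>

definition cover_arcs :: "'a rel \<Rightarrow> 'a rel" where
  "cover_arcs R = R - R O R\<^sup>+"

text \<open>A relational form of being a forest: each edge of the underlying undirected graph is a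
  bridge. It needs reachability only and no cycles as lists.\<close>

definition bypass_free :: "'a rel \<Rightarrow> bool" where
  "bypass_free H \<longleftrightarrow> (\<forall>(a, b) \<in> H. (a, b) \<notin> (H \<union> H\<inverse> - {(a, b), (b, a)})\<^sup>*)"

definition reorient :: "'a rel \<Rightarrow> 'a rel \<Rightarrow> 'a rel" where
  "reorient A S = A - S \<union> S\<inverse>"

text \<open>The poset in the encoding by reversed arcs, where its order is plain inclusion.\<close>

definition acyclic_reversals :: "'a rel \<Rightarrow> 'a rel set" where
  "acyclic_reversals A = {S. S \<subseteq> A \<and> acyclic (reorient A S)}"

text \<open>Imposed on \<open>S\<close> and on \<open>A - S\<close>, this is the analogue of the
  closed and coclosed sets that describe inversion sets of permutations.\<close>

definition path_closed :: "'a rel \<Rightarrow> 'a rel \<Rightarrow> bool" where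
  "path_closed A S \<longleftrightarrow> A \<inter> S\<^sup>+ \<subseteq> S"

section \<open>Acyclic relations and restricted paths\<close>

lemma acyclic_irreflD: "acyclic R \<Longrightarrow> (x, x) \<notin> R"
  by (auto simp: acyclic_def)

lemma acyclic_asymD: "acyclic R \<Longrightarrow> (x, y) \<in> R \<Longrightarrow> (y, x) \<notin> R"
  by (meson acyclic_def r_into_trancl trancl_into_trancl2)

lemma acyclic_no_return: "acyclic R \<Longrightarrow> (x, y) \<in> R \<Longrightarrow> (y, x) \<notin> R\<^sup>*"
  by (meson acyclic_def rtrancl_into_trancl2)

text \<open>All vertices of a path from \<open>a\<close> to \<open>b\<close> lie between
  \<open>a\<close> and \<open>b\<close>, so it is enough that \<open>U\<close> contains this
  interval.\<close>

lemma rtrancl_Restr_interval: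
  assumes "(a, b) \<in> R\<^sup>*" "\<And>x. (a, x) \<in> R\<^sup>* \<Longrightarrow> (x, b) \<in> R\<^sup>* \<Longrightarrow> x \<in> U"
  shows "(a, b) \<in> (Restr R U)\<^sup>*"
proof -
  have "(a, x) \<in> R\<^sup>* \<Longrightarrow> (x, b) \<in> (Restr R U)\<^sup>*" if "(x, b) \<in> R\<^sup>*" for x
    using that
  proof (induction rule: converse_rtrancl_induct)
    case (step y z)
    have "(a, z) \<in> R\<^sup>*" using step by auto
    moreover have "y \<in> U" "z \<in> U"
      using assms(2) step \<open>(a, z) \<in> R\<^sup>*\<close> by (auto intro: converse_rtrancl_into_rtrancl)
    ultimately show ?case using step by (auto intro: converse_rtrancl_into_rtrancl)
  qed simp
  then show ?thesis using assms(1) by blast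
qed

text \<open>Used to see that a path avoids a removed arc: only arcs leaving vertices reachable from
  \<open>a\<close> have to survive.\<close>

lemma rtrancl_restrict_reachable:
  assumes "(a, b) \<in> R\<^sup>*" "\<And>x y. (a, x) \<in> R\<^sup>* \<Longrightarrow> (x, y) \<in> R \<Longrightarrow> (x, y) \<in> K"
  shows "(a, b) \<in> K\<^sup>*"
  using assms(1)
  by (induction rule: rtrancl_induct) (auto intro: assms(2) rtrancl_into_rtrancl)

text \<open>A cycle that leaves \<open>U\<close> cannot come back, so every cycle lies entirely in
  \<open>U\<close> or entirely outside.\<close>

lemma acyclic_if_no_arc_into:
  assumes "acyclic (Restr R U)" "acyclic (Restr R (-U))" "R \<inter> (-U) \<times> U = {}"
  shows "acyclic R"
proof (rule acyclicI, intro allI notI)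
  fix x assume x: "(x, x) \<in> R\<^sup>+"
  have out: "b \<notin> U \<and> (a, b) \<in> (Restr R (-U))\<^sup>+" if "(a, b) \<in> R\<^sup>+" "a \<notin> U" for a b
    using that
  proof (induction rule: trancl_induct)
    case (base y) then show ?case using assms(3) by (auto intro!: r_into_trancl)
  next
    case (step y z)
    then have "(y, z) \<in> Restr R (-U)" using assms(3) by auto
    then show ?case using step by (auto intro: trancl_into_trancl)
  qed
  have inside: "a \<in> U \<and> (a, b) \<in> (Restr R U)\<^sup>+" if "(a, b) \<in> R\<^sup>+" "b \<in> U" for a b
    using that
  proof (induction rule: converse_trancl_induct)
    case (base y) then show ?case using assms(3) by (auto intro!: r_into_trancl)
  next
    case (step y z)
    then have "(y, z) \<in> Restr R U" using assms(3) by auto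
    then show ?case using step by (auto intro: trancl_into_trancl2)
  qed
  show False using out[OF x] inside[OF x] assms(1,2) by (auto simp: acyclic_def)
qed

text \<open>A cycle through the reversed arc contains a path from \<open>u\<close> to
  \<open>v\<close> that avoids \<open>(u, v)\<close>. Such a path has at least two arcs, which a
  cover excludes.\<close>

lemma acyclic_reorient_single:
  assumes "acyclic B" "(u, v) \<in> cover_arcs B"
  shows "acyclic (reorient B {(u, v)})"
proof -
  have uv: "(u, v) \<in> B" "(u, v) \<notin> B O B\<^sup>+" using assms(2) by (auto simp: cover_arcs_def)
  have "(u, v) \<notin> (B - {(u, v)})\<^sup>*"
  proof
    assume "(u, v) \<in> (B - {(u, v)})\<^sup>*"
    moreover have "u \<noteq> v" using uv assms(1) acyclic_irreflD by metis
    ultimately obtain w where w: "(u, w) \<in> B - {(u, v)}" "(w, v) \<in> (B - {(u, v)})\<^sup>*"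
      by (metis converse_rtranclE)
    then have "w \<noteq> v" "(w, v) \<in> B\<^sup>*" by (auto intro: rtrancl_mono[THEN subsetD])
    then have "(w, v) \<in> B\<^sup>+" by (metis rtranclD)
    then show False using uv w by blast
  qed
  moreover have "acyclic (B - {(u, v)})" using assms(1) by (rule acyclic_subset) blast
  moreover have "reorient B {(u, v)} = insert (v, u) (B - {(u, v)})"
    by (auto simp: reorient_def)
  ultimately show ?thesis by simp
qed

section \<open>Complements, path closure and induced subgraphs\<close>

lemma reorient_complement: "S \<subseteq> A \<Longrightarrow> reorient A (A - S) = (reorient A S)\<inverse>"
  by (auto simp: reorient_def)

text \<open>The complement yields the opposite digraph. This order-reversing involution exchanges
  joins and meets.\<close>

lemma acyclic_reversals_complement:
  "S \<in> acyclic_reversals A \<Longrightarrow> A - S \<in> acyclic_reversals A"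
  by (auto simp: acyclic_reversals_def reorient_complement)

text \<open>An unreversed arc \<open>(u, v)\<close> together with a reversed path from
  \<open>u\<close> to \<open>v\<close> closes up to a directed cycle.\<close>

lemma acyclic_reversals_path_closed:
  assumes "S \<in> acyclic_reversals A"
  shows "path_closed A S"
  unfolding path_closed_def
proof (intro subsetI, rule ccontr)
  fix e assume e: "e \<in> A \<inter> S\<^sup>+" "e \<notin> S"
  obtain u v where uv: "e = (u, v)" by (cases e)
  have "(v, u) \<in> (S\<inverse>)\<^sup>+" using e uv by (simp add: trancl_converse)
  then have "(v, u) \<in> (reorient A S)\<^sup>+"
    by (rule trancl_mono) (auto simp: reorient_def)
  moreover have "(u, v) \<in> reorient A S" using e uv by (auto simp: reorient_def)
  ultimately show False
    using assms by (auto simp: acyclic_reversals_def acyclic_def dest: trancl_into_trancl)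
qed

text \<open>Every vertex outside \<open>U\<close> is placed above all of \<open>U\<close>, so that reorienting inside \<open>U\<close>
  is unaffected by the rest of the digraph.\<close>

lemma acyclic_reversals_lift:
  assumes "acyclic A" "T \<in> acyclic_reversals (Restr A U)"
  shows "A \<inter> (-U) \<times> U \<union> T \<in> acyclic_reversals A"
proof -
  let ?S = "A \<inter> (-U) \<times> U \<union> T"
  have T: "T \<subseteq> Restr A U" "acyclic (reorient (Restr A U) T)"
    using assms(2) by (auto simp: acyclic_reversals_def)
  have "acyclic (reorient A ?S)"
  proof (rule acyclic_if_no_arc_into[of _ U])
    have "Restr (reorient A ?S) U = reorient (Restr A U) T"
      using T(1) by (auto simp: reorient_def)
    then show "acyclic (Restr (reorient A ?S) U)" using T(2) by simp
    have "Restr (reorient A ?S) (-U) \<subseteq> A"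
      using T(1) by (auto simp: reorient_def)
    then show "acyclic (Restr (reorient A ?S) (-U))"
      using assms(1) acyclic_subset by blast
    show "reorient A ?S \<inter> (-U) \<times> U = {}" using T(1) by (auto simp: reorient_def)
  qed
  then show ?thesis using T(1) by (auto simp: acyclic_reversals_def)
qed

text \<open>\<open>C\<close> is a choice of directions for some edges of a transitive reduction; for
  an undirected cycle it would be one way around. The join of the single forward arcs, lifted by
  \<open>S0\<close>, reverses all forward and no backward arcs of \<open>C\<close>, which makes
  \<open>C\<inverse>\<close> part of an acyclic reorientation.\<close>

lemma cyclic_cover_arcs_no_joins:
  assumes A: "acyclic A" "finite A"
    and joins: "\<And>S T. S \<in> acyclic_reversals A \<Longrightarrow> T \<in> acyclic_reversals A \<Longrightarrow>
      \<exists>J \<in> acyclic_reversals A. S \<union> T \<subseteq> J \<and> (\<forall>K \<in> acyclic_reversals A. S \<union> T \<subseteq> K \<longrightarrow> J \<subseteq> K)"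
    and C: "C \<subseteq> cover_arcs (Restr A U) \<union> (cover_arcs (Restr A U))\<inverse>" "C \<inter> C\<inverse> = {}"
  shows "acyclic C"
proof -
  define B where "B = Restr A U"
  define H where "H = cover_arcs B"
  define S0 where "S0 = A \<inter> (-U) \<times> U"
  have B: "acyclic B" "B \<subseteq> A" using A(1) by (auto simp: B_def intro: acyclic_subset)
  have HB: "H \<subseteq> B" by (auto simp: H_def cover_arcs_def)
  have single: "{c} \<in> acyclic_reversals B" if "c \<in> H" for c
    using acyclic_reorient_single[OF B(1)] that HB
    by (cases c) (auto simp: acyclic_reversals_def H_def)
  have low: "insert c S0 \<in> acyclic_reversals A" if "c \<in> H" for c
    using acyclic_reversals_lift[OF A(1), of "{c}" U] single[OF that] by (simp add: B_def S0_def)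
  have up: "S0 \<union> (B - {d}) \<in> acyclic_reversals A" if "d \<in> H" for d
    using acyclic_reversals_lift[OF A(1), of "B - {d}" U]
      acyclic_reversals_complement[OF single[OF that]] by (simp add: B_def S0_def)
  \<comment> \<open>Binary joins give finite ones by induction; the empty family has the join
    \<open>{}\<close>.\<close>
  have family_join: "\<exists>J \<in> acyclic_reversals A. \<Union>F \<subseteq> J \<and> (\<forall>K \<in> acyclic_reversals A. \<Union>F \<subseteq> K \<longrightarrow> J \<subseteq> K)"
    if "finite F" "F \<subseteq> acyclic_reversals A" for F
    using that
  proof (induction rule: finite_induct)
    case empty
    have "{} \<in> acyclic_reversals A" using A(1) by (simp add: acyclic_reversals_def reorient_def)
    then show ?case by auto
  next
    case (insert S F)
    then obtain J where J: "J \<in> acyclic_reversals A" "\<Union>F \<subseteq> J"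
      "\<forall>K \<in> acyclic_reversals A. \<Union>F \<subseteq> K \<longrightarrow> J \<subseteq> K" by auto
    with joins[of S J] insert.prems obtain J' where "J' \<in> acyclic_reversals A" "S \<union> J \<subseteq> J'"
      "\<forall>K \<in> acyclic_reversals A. S \<union> J \<subseteq> K \<longrightarrow> J' \<subseteq> K" by auto
    with J show ?case by (intro bexI[of _ J']) auto
  qed
  have "finite ((\<lambda>c. insert c S0) ` (C \<inter> H))"
    using A(2) B(2) HB by (meson finite_Int finite_imageI finite_subset)
  moreover have "(\<lambda>c. insert c S0) ` (C \<inter> H) \<subseteq> acyclic_reversals A" using low by auto
  ultimately obtain J where J: "J \<in> acyclic_reversals A" "\<Union>((\<lambda>c. insert c S0) ` (C \<inter> H)) \<subseteq> J"
    "\<forall>K \<in> acyclic_reversals A. \<Union>((\<lambda>c. insert c S0) ` (C \<inter> H)) \<subseteq> K \<longrightarrow> J \<subseteq> K"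
    using family_join by meson
  \<comment> \<open>Here \<open>d\<close> is an arc that \<open>C\<close> traverses backwards. It
    differs from every forward arc \<open>c\<close> because \<open>C\<close> and
    \<open>C\<inverse>\<close> are disjoint, so reversing all of \<open>B\<close> except
    \<open>d\<close> is an upper bound.\<close>
  have "d \<notin> J" if "d \<in> H" "d \<in> C\<inverse>" for d
  proof -
    have "insert c S0 \<subseteq> S0 \<union> (B - {d})" if "c \<in> C \<inter> H" for c
      using that \<open>d \<in> C\<inverse>\<close> C(2) HB by auto
    then have "J \<subseteq> S0 \<union> (B - {d})" using J(3) up[OF \<open>d \<in> H\<close>] by (meson UN_least)
    moreover have "d \<notin> S0" using HB that by (auto simp: S0_def B_def)
    ultimately show ?thesis by auto
  qed
  moreover have "C \<inter> H \<subseteq> J" using J(2) by auto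
  ultimately have "C\<inverse> \<subseteq> reorient A J"
    using C(1) HB B(2) unfolding H_def[symmetric] B_def[symmetric] reorient_def by blast
  moreover have "acyclic (reorient A J)" using J(1) by (simp add: acyclic_reversals_def)
  ultimately show ?thesis using acyclic_subset acyclic_converse by metis
qed


section \<open>Joins from forests\<close>

lemma trancl_cover_arcs:
  assumes "finite B" "acyclic B"
  shows "(cover_arcs B)\<^sup>+ = B\<^sup>+"
proof
  show "(cover_arcs B)\<^sup>+ \<subseteq> B\<^sup>+" by (intro trancl_mono_subset) (auto simp: cover_arcs_def)
  have wf: "wf (B\<inverse>)" and wf': "wf B"
    using assms by (simp_all add: finite_acyclic_wf_converse finite_acyclic_wf)
  have *: "(x, y) \<in> B\<^sup>+ \<Longrightarrow> (x, y) \<in> (cover_arcs B)\<^sup>+" for x y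
  \<comment> \<open>Two nested inductions shrink the interval from \<open>x\<close> to
    \<open>y\<close>: at an intermediate \<open>w\<close>, the half ending in \<open>w\<close> falls
    to the inner hypothesis and the half starting in \<open>w\<close> to the outer one.\<close>
  proof (induction x arbitrary: y rule: wf_induct_rule[OF wf_trancl[OF wf]])
    case outer: (1 x)
    show ?case
      using outer.prems
    proof (induction y rule: wf_induct_rule[OF wf_trancl[OF wf']])
      case inner: (1 y)
      show ?case
      proof (cases "(x, y) \<in> cover_arcs B")
        case False
        then obtain w where w: "(x, w) \<in> B" "(w, y) \<in> B\<^sup>+"
          using inner.prems by (auto simp: cover_arcs_def elim: converse_tranclE)
        have "(x, w) \<in> (cover_arcs B)\<^sup>+" using w inner.IH by auto
        moreover have "(w, y) \<in> (cover_arcs B)\<^sup>+" using w outer.IH by auto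
        ultimately show ?thesis by simp
      qed auto
    qed
  qed
  show "B\<^sup>+ \<subseteq> (cover_arcs B)\<^sup>+" using * by auto
qed

text \<open>Two covers of \<open>p\<close> below a common \<open>v\<close> close up to an undirected cycle through \<open>p\<close>.\<close>

lemma bypass_free_no_fork:
  assumes H: "bypass_free H" "acyclic H"
    and p: "(p, x) \<in> H" "(p, y) \<in> H" and v: "(x, v) \<in> H\<^sup>*" "(y, v) \<in> H\<^sup>*"
  shows "x = y"
proof (rule ccontr)
  assume "x \<noteq> y"
  define K where "K = H \<union> H\<inverse> - {(p, x), (x, p)}"
  have xp: "(x, p) \<notin> H" using acyclic_asymD[OF H(2) p(1)] .
  \<comment> \<open>By acyclicity a path that starts at a successor of \<open>p\<close> never
    returns to \<open>p\<close>, hence does not use the edge between \<open>p\<close> and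
    \<open>x\<close>.\<close>
  have avoid: "(z, v) \<in> K\<^sup>*" if "(z, v) \<in> H\<^sup>*" "(p, z) \<in> H" for z
    using that(1)
  proof (rule rtrancl_restrict_reachable)
    fix a b assume "(z, a) \<in> H\<^sup>*" "(a, b) \<in> H"
    then have "a \<noteq> p" using acyclic_no_return[OF H(2) that(2)] by auto
    then show "(a, b) \<in> K" using \<open>(a, b) \<in> H\<close> xp by (auto simp: K_def)
  qed
  have "sym K" by (auto simp: K_def sym_def)
  then have "(v, x) \<in> K\<^sup>*" using avoid[OF v(1) p(1)] by (meson sym_rtrancl symD)
  moreover have "(p, y) \<in> K" using p \<open>x \<noteq> y\<close> xp by (auto simp: K_def)
  ultimately have "(p, x) \<in> K\<^sup>*"
    using avoid[OF v(2) p(2)] by (meson converse_rtrancl_into_rtrancl rtrancl_trans)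
  then show False using H(1) p(1) by (auto simp: bypass_free_def K_def)
qed

text \<open>The last arc of a longer path from \<open>p\<close> to \<open>x\<close> would start in
  \<open>p\<close> again.\<close>

lemma cover_arcs_if_unique_predecessor:
  assumes "acyclic B" "(p, x) \<in> B" "\<And>z. (z, x) \<in> B \<Longrightarrow> z = p"
  shows "(p, x) \<in> cover_arcs B"
proof -
  have "(p, x) \<notin> B O B\<^sup>+"
  proof
    assume "(p, x) \<in> B O B\<^sup>+"
    then obtain w where w: "(p, w) \<in> B" "(w, x) \<in> B\<^sup>+" by blast
    then obtain z where "(w, z) \<in> B\<^sup>*" "(z, x) \<in> B" by (metis tranclD2)
    then show False using assms w acyclic_no_return by metis
  qed
  then show ?thesis using assms(2) by (simp add: cover_arcs_def)
qed

text \<open>Take a counterexample with \<open>p\<close> as late as possible and let \<open>x\<close>, \<open>y\<close> be the second vertices of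
  the two paths. Among \<open>p\<close> and the vertices on continuations of the two paths to \<open>v\<close>, any
  predecessor of \<open>x\<close> or \<open>y\<close> other than \<open>p\<close> would be a later counterexample. So both arcs out of
  \<open>p\<close> are covers there, and they fork towards \<open>v\<close>.\<close>

lemma no_path_inside_and_outside:
  assumes A: "finite A" "acyclic A" and forest: "\<And>U. bypass_free (cover_arcs (Restr A U))"
    and S: "S \<subseteq> A" "path_closed A (A - S)" and T: "T \<subseteq> A" "path_closed A (A - T)"
    and paths: "(p, v) \<in> (S \<union> T)\<^sup>+" "(p, v) \<in> (A - (S \<union> T)\<^sup>+)\<^sup>+"
  shows False
proof -
  define X where "X = S \<union> T"
  define N where "N = A - X\<^sup>+"
  have XA: "X \<subseteq> A" "N \<subseteq> A" "X \<inter> N = {}" using S T by (auto simp: X_def N_def)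
  have "wf (A\<inverse>)" using A by (simp add: finite_acyclic_wf_converse)
  then have "wf ((A\<inverse>)\<^sup>+)" by (rule wf_trancl)
  then have "(p, v) \<in> X\<^sup>+ \<longrightarrow> (p, v) \<notin> N\<^sup>+"
  proof (induction p rule: wf_induct_rule)
    case (less p)
    show ?case
    proof (intro impI notI)
      assume "(p, v) \<in> X\<^sup>+" "(p, v) \<in> N\<^sup>+"
      then obtain x y where x: "(p, x) \<in> X" "(x, v) \<in> X\<^sup>*" and y: "(p, y) \<in> N" "(y, v) \<in> N\<^sup>*"
        by (metis tranclD)
      have xA: "(p, x) \<in> A" and yA: "(p, y) \<in> A" using x y XA by auto
      have inA: "(a, b) \<in> A\<^sup>*" if "(a, b) \<in> X\<^sup>* \<or> (a, b) \<in> N\<^sup>*" for a b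
        using that XA rtrancl_mono by blast
      have IH: "(z, v) \<notin> X\<^sup>+ \<or> (z, v) \<notin> N\<^sup>+" if "(p, z) \<in> A\<^sup>+" for z
        using less that by (simp add: trancl_converse)
      \<comment> \<open>Taking whole intervals instead of two chosen paths ensures that every vertex
        of \<open>U\<close> except \<open>p\<close> has a path from \<open>p\<close> and a path to
        \<open>v\<close>, both in \<open>X\<close> or both in \<open>N\<close>.\<close>
      define U where "U = {p} \<union> {z. (x, z) \<in> X\<^sup>* \<and> (z, v) \<in> X\<^sup>*} \<union> {z. (y, z) \<in> N\<^sup>* \<and> (z, v) \<in> N\<^sup>*}"
      define B where "B = Restr A U"
      have B: "finite B" "acyclic B" using A by (auto simp: B_def intro: acyclic_subset)
      \<comment> \<open>Such a \<open>z\<close> lies on the \<open>X\<close> side. The arc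
        \<open>(z, y)\<close> is in \<open>N\<close>, since otherwise \<open>X\<close> would contain
        a path from \<open>p\<close> to \<open>y\<close>; hence \<open>z\<close> reaches
        \<open>v\<close> in both ways.\<close>
      have "z = p" if z: "(z, y) \<in> B" for z
      proof (rule ccontr)
        assume "z \<noteq> p"
        have zA: "(z, y) \<in> A" "z \<in> U" using z by (auto simp: B_def)
        have "(y, z) \<notin> N\<^sup>*" using acyclic_no_return[OF A(2) zA(1)] inA by blast
        then have xz: "(x, z) \<in> X\<^sup>*" "(z, v) \<in> X\<^sup>*" using zA \<open>z \<noteq> p\<close> by (auto simp: U_def)
        have "(p, z) \<in> X\<^sup>+" using x xz by (meson rtrancl_into_trancl2)
        moreover have "(z, y) \<notin> X\<^sup>+"
        proof
          assume "(z, y) \<in> X\<^sup>+"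
          with \<open>(p, z) \<in> X\<^sup>+\<close> have "(p, y) \<in> X\<^sup>+" by simp
          then show False using y by (simp add: N_def)
        qed
        ultimately have "(z, y) \<in> N" using zA by (simp add: N_def)
        then have "(z, v) \<in> N\<^sup>+" using y by (meson rtrancl_into_trancl2)
        moreover have "z \<noteq> v" using acyclic_no_return[OF A(2) zA(1)] y inA by blast
        then have "(z, v) \<in> X\<^sup>+" using xz by (metis rtranclD)
        moreover have "(p, z) \<in> A\<^sup>+" using xA xz inA by (meson rtrancl_into_trancl2)
        ultimately show False using IH by blast
      qed
      moreover have "z = p" if z: "(z, x) \<in> B" for z
      proof (rule ccontr)
        assume "z \<noteq> p"
        have zA: "(z, x) \<in> A" "z \<in> U" using z by (auto simp: B_def)
        have "(x, z) \<notin> X\<^sup>*" using acyclic_no_return[OF A(2) zA(1)] inA by blast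
        then have yz: "(y, z) \<in> N\<^sup>*" "(z, v) \<in> N\<^sup>*" using zA \<open>z \<noteq> p\<close> by (auto simp: U_def)
        have "(p, z) \<in> N\<^sup>+" using y yz by (meson rtrancl_into_trancl2)
        \<comment> \<open>To be used with \<open>Y\<close> as \<open>S\<close> or \<open>T\<close>,
          whichever contains \<open>(p, x)\<close>. If \<open>(z, x)\<close> were outside
          \<open>Y\<close>, the path through \<open>N\<close> to \<open>z\<close> and on to
          \<open>x\<close> would avoid \<open>Y\<close>, and closure of the complement would expel
          \<open>(p, x)\<close> from \<open>Y\<close>.\<close>
        have zX: "(z, x) \<in> Y" if Y: "(p, x) \<in> Y" "path_closed A (A - Y)" "Y \<subseteq> X" for Y
        proof (rule ccontr)
          assume "(z, x) \<notin> Y"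
          have "N \<subseteq> A - Y" using Y(3) by (auto simp: N_def)
          then have "(p, z) \<in> (A - Y)\<^sup>+" using \<open>(p, z) \<in> N\<^sup>+\<close> trancl_mono by blast
          then have "(p, x) \<in> (A - Y)\<^sup>+"
            using \<open>(z, x) \<notin> Y\<close> zA by (auto intro: trancl_into_trancl)
          then show False using Y xA by (auto simp: path_closed_def)
        qed
        have "(z, x) \<in> X"
          using x(1) zX[of S] zX[of T] S T by (auto simp: X_def)
        then have "(z, v) \<in> X\<^sup>+" using x by (meson rtrancl_into_trancl2)
        moreover have "z \<noteq> v" using acyclic_no_return[OF A(2) zA(1)] x inA by blast
        then have "(z, v) \<in> N\<^sup>+" using yz by (metis rtranclD)
        moreover have "(p, z) \<in> A\<^sup>+" using yA yz inA by (meson rtrancl_into_trancl2)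
        ultimately show False using IH by blast
      qed
      moreover have "(p, x) \<in> B" "(p, y) \<in> B" using x y xA yA by (auto simp: B_def U_def)
      ultimately have px: "(p, x) \<in> cover_arcs B" and py: "(p, y) \<in> cover_arcs B"
        using cover_arcs_if_unique_predecessor[OF B(2)] by blast+
      have "(x, v) \<in> (Restr X U)\<^sup>*"
        by (rule rtrancl_Restr_interval[OF x(2)]) (simp add: U_def)
      moreover have "(y, v) \<in> (Restr N U)\<^sup>*"
        by (rule rtrancl_Restr_interval[OF y(2)]) (simp add: U_def)
      moreover have "Restr X U \<subseteq> B" "Restr N U \<subseteq> B" using XA by (auto simp: B_def)
      ultimately have "(x, v) \<in> B\<^sup>*" "(y, v) \<in> B\<^sup>*" using rtrancl_mono by blast+
      \<comment> \<open>Paths in \<open>B\<close> refine to paths of covers, so the fork becomes one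
        in the transitive reduction.\<close>
      then have "(x, v) \<in> (cover_arcs B)\<^sup>*" "(y, v) \<in> (cover_arcs B)\<^sup>*"
        using trancl_cover_arcs[OF B] by (metis rtrancl_trancl_reflcl)+
      then have "x = y"
        using bypass_free_no_fork[OF _ _ px py] forest[of U] B(2)
        by (auto simp: B_def cover_arcs_def intro: acyclic_subset)
      then show False using x y XA by auto
    qed
  qed
  then show False using paths by (simp add: X_def N_def)
qed

section \<open>Shortest directed cycles and their detours\<close>

lemma relpow_walk:
  assumes "\<And>i. (g i, g (Suc i)) \<in> E"
  shows "(g a, g (a + k)) \<in> E ^^ k"
  using assms by (induction k) auto

text \<open>A shortest directed cycle, extended periodically to all indices so that rotating it is a
  mere shift.\<close>

lemma shortest_cycle:
  assumes "\<not> acyclic E" "irrefl E"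
  obtains g :: "nat \<Rightarrow> 'a" and n where
    "0 < n" "\<And>i. (g i, g (Suc i)) \<in> E" "\<And>i. g (i + n) = g i"
    "\<And>i j. g i = g j \<Longrightarrow> i \<le> j \<Longrightarrow> j < i + n \<Longrightarrow> j = i"
    "\<And>i j. (g i, g j) \<in> E \<Longrightarrow> i \<le> j \<Longrightarrow> j < i + n \<Longrightarrow> j = Suc i"
proof -
  define P where "P n \<longleftrightarrow> 0 < n \<and> (\<exists>x. (x, x) \<in> E ^^ n)" for n
  have "\<exists>n. P n" using assms(1) by (auto simp: acyclic_def trancl_power P_def)
  then obtain n where "P n" and least: "\<And>m. m < n \<Longrightarrow> \<not> P m" using exists_least_iff[of P] by blast
  then have n: "0 < n" "\<exists>x. (x, x) \<in> E ^^ n"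
    and min: "\<And>m x. m < n \<Longrightarrow> 0 < m \<Longrightarrow> (x, x) \<notin> E ^^ m"
    by (auto simp: P_def)
  then obtain f where f: "f 0 = f n" "\<And>i. i < n \<Longrightarrow> (f i, f (Suc i)) \<in> E"
    unfolding relpow_fun_conv by metis
  define g where "g i = f (i mod n)" for i
  have step: "(g i, g (Suc i)) \<in> E" for i
    using f(1) f(2)[of "i mod n"] n(1) by (auto simp: g_def mod_Suc)
  have period: "g (i + n) = g i" for i by (simp add: g_def)
  show thesis
  proof (rule that[OF n(1) step period])
    fix i j assume eq: "g i = g j" and ij: "i \<le> j" "j < i + n"
    have "(g i, g j) \<in> E ^^ (j - i)" using relpow_walk[where g = g, OF step, of i "j - i"] ij by simp
    then have "\<not> (j - i < n \<and> 0 < j - i)" using min[of "j - i" "g i"] eq by metis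
    then show "j = i" using ij by linarith
  next
    fix i j assume e: "(g i, g j) \<in> E" and ij: "i \<le> j" "j < i + n"
    \<comment> \<open>Going on from \<open>g j\<close> to the end of the period and closing up by
      the chord gives a cycle of length \<open>i + n - j + 1\<close>; minimality of \<open>n\<close>
      forces \<open>j \<le> Suc i\<close>.\<close>
    have "(g j, g i) \<in> E ^^ (i + n - j)"
      using relpow_walk[where g = g, OF step, of j "i + n - j"] ij period[of i] by simp
    then have "(g j, g j) \<in> E ^^ Suc (i + n - j)" using e by (rule relpow_Suc_I)
    then have "\<not> Suc (i + n - j) < n" using min by blast
    then have "j \<le> Suc i" using ij by linarith
    moreover have "j \<noteq> i" using e assms(2) by (auto simp: irrefl_def)
    ultimately show "j = Suc i" using ij by simp
  qed
qed

text \<open>In an induced cycle, the only way around a single edge is the rest of the cycle.\<close>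

lemma chordless_cycle_detour:
  fixes h :: "nat \<Rightarrow> 'a"
  assumes A: "acyclic A" "E \<union> E\<inverse> = A \<union> A\<inverse>"
    and inj: "inj_on h {..m}" and step: "\<And>i. i < m \<Longrightarrow> (h i, h (Suc i)) \<in> E"
    and chord: "\<And>i j. i \<le> m \<Longrightarrow> j \<le> m \<Longrightarrow> (h i, h j) \<in> E \<Longrightarrow> j = Suc i \<or> i = m \<and> j = 0"
    and B: "B = Restr A (h ` {..m})"
    and detour: "(h m, h 0) \<in> A" "(h m, h 0) \<in> B O B\<^sup>+"
  shows "(h m, h 0) \<in> (A \<inter> E\<inverse>)\<^sup>+"
proof -
  define K where "K = B - {(h m, h 0)}"
  have acB: "acyclic B" using A(1) by (auto simp: B intro: acyclic_subset)
  have base: "(h m, h 0) \<in> K\<^sup>*"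
  proof -
    obtain w where w: "(h m, w) \<in> B" "(w, h 0) \<in> B\<^sup>+" using detour(2) by blast
    have "(w, h 0) \<in> K\<^sup>*"
    proof (rule rtrancl_restrict_reachable)
      show "(w, h 0) \<in> B\<^sup>*" using w(2) by simp
      fix a b assume "(w, a) \<in> B\<^sup>*" "(a, b) \<in> B"
      then show "(a, b) \<in> K" using acyclic_no_return[OF acB w(1)] by (auto simp: K_def)
    qed
    moreover have "(h m, w) \<in> K" using w acB by (auto simp: K_def acyclic_def)
    ultimately show ?thesis by (meson converse_rtrancl_into_rtrancl)
  qed
  \<comment> \<open>The detour is traced backwards from \<open>h 0\<close>. The arc entering
    \<open>h j\<close> cannot run along \<open>E\<close>: it would be opposite to the arc found
    before, or be the removed arc. So it comes from \<open>h (Suc j)\<close>.\<close>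
  have "j \<le> m \<Longrightarrow> (h m, h j) \<in> K\<^sup>* \<and> (\<forall>i<j. (h (Suc i), h i) \<in> A)" for j
  proof (induction j)
    case (Suc j)
    then have IH: "(h m, h j) \<in> K\<^sup>*" "\<forall>i<j. (h (Suc i), h i) \<in> A" by auto
    have "h m \<noteq> h j" using inj Suc.prems by (auto dest!: inj_onD)
    then obtain w where w: "(h m, w) \<in> K\<^sup>*" "(w, h j) \<in> K" using IH(1) by (metis rtranclE)
    then obtain k where k: "w = h k" "k \<le> m" by (auto simp: K_def B)
    have kA: "(h k, h j) \<in> A" using w k by (auto simp: K_def B)
    have "(h k, h j) \<notin> E"
    proof
      assume "(h k, h j) \<in> E"
      then have "j = Suc k \<or> k = m \<and> j = 0" using chord k Suc.prems by auto
      then show False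
        using IH(2) acyclic_asymD[OF A(1) kA] w k by (auto simp: K_def)
    qed
    then have "(h j, h k) \<in> E" using kA A(2) by blast
    then have "k = Suc j" using chord[of j k] k Suc.prems by auto
    then show ?case using w k kA IH(2) by (auto simp: less_Suc_eq)
  qed (use base in auto)
  then have down: "(h (Suc i), h i) \<in> A \<inter> E\<inverse>" if "i < m" for i using step that by auto
  have "j \<le> m \<Longrightarrow> (h j, h 0) \<in> (A \<inter> E\<inverse>)\<^sup>*" for j
  proof (induction j)
    case (Suc j)
    then show ?case using down[of j] by (meson Suc_le_lessD converse_rtrancl_into_rtrancl less_imp_le)
  qed simp
  then show ?thesis
    using detour(1) A(1) by (metis acyclic_irreflD order_refl rtranclD)
qed

text \<open>Consider the subgraph induced by a shortest directed cycle. A non-cover arc there is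
  spanned by the rest of the cycle, which lies wholly in \<open>S\<close> or wholly in
  \<open>A - S\<close>, against one of the closure conditions. So all its arcs are covers, and they
  form an undirected cycle in a forest.\<close>

lemma acyclic_reorient_if_path_closed:
  assumes A: "acyclic A" and forest: "\<And>U. bypass_free (cover_arcs (Restr A U))"
    and S: "S \<subseteq> A" "path_closed A S" "path_closed A (A - S)"
  shows "acyclic (reorient A S)"
proof (rule ccontr)
  define E where "E = reorient A S"
  assume "\<not> acyclic (reorient A S)"
  then have nonac: "\<not> acyclic E" by (simp add: E_def)
  have asymA: "(x, y) \<in> A \<Longrightarrow> (y, x) \<notin> A" for x y using A by (rule acyclic_asymD)
  have EA: "E \<union> E\<inverse> = A \<union> A\<inverse>" using S(1) by (auto simp: E_def reorient_def)
  have asymE: "(x, y) \<in> E \<Longrightarrow> (y, x) \<notin> E" for x y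
    using S(1) asymA by (auto simp: E_def reorient_def)
  have irrE: "irrefl E" using asymE by (auto simp: irrefl_def)
  have SE: "A \<inter> E\<inverse> = S" "A \<inter> E = A - S" using S(1) asymA by (auto simp: E_def reorient_def)
  obtain g :: "nat \<Rightarrow> 'a" and n where g: "0 < n" "\<And>i. (g i, g (Suc i)) \<in> E" "\<And>i. g (i + n) = g i"
    and g_inj: "\<And>i j. g i = g j \<Longrightarrow> i \<le> j \<Longrightarrow> j < i + n \<Longrightarrow> j = i"
    and g_chord: "\<And>i j. (g i, g j) \<in> E \<Longrightarrow> i \<le> j \<Longrightarrow> j < i + n \<Longrightarrow> j = Suc i"
    using shortest_cycle[OF nonac irrE] by metis
  define m where "m = n - 1"
  have n: "n = Suc m" using g(1) by (simp add: m_def)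
  define U where "U = range g"
  define B where "B = Restr A U"
  have g_mult: "g (a + k * n) = g a" for a k
  proof (induction k)
    case (Suc k)
    then show ?case using g(3)[of "a + k * n"] by (simp add: ac_simps)
  qed simp
  have g_range: "\<exists>i\<le>m. g k = g (s + i)" for k s
  proof -
    \<comment> \<open>Adding \<open>s\<close> periods lifts the index to at least \<open>s\<close>,
      so that no truncated subtraction arises.\<close>
    have "g k = g (k + s * n)" by (simp add: g_mult)
    also have "k + s * n = s + (k + s * m)" by (simp add: n)
    also have "\<dots> = s + (k + s * m) mod n + (k + s * m) div n * n" by simp
    also have "g \<dots> = g (s + (k + s * m) mod n)" by (rule g_mult)
    finally show ?thesis using g(1) n by (intro exI[of _ "(k + s * m) mod n"]) (simp add: less_Suc_eq_le[symmetric])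
  qed
  have U: "(\<lambda>i. g (s + i)) ` {..m} = U" for s using g_range[of _ s] by (auto simp: U_def image_iff)
  have inj: "inj_on (\<lambda>i. g (s + i)) {..m}" for s
  proof (rule linorder_inj_onI)
    show "i < j \<Longrightarrow> i \<in> {..m} \<Longrightarrow> j \<in> {..m} \<Longrightarrow> g (s + i) \<noteq> g (s + j)" for i j
      using g_inj[of "s + i" "s + j"] n by auto
  qed auto
  have chord: "j = Suc i \<or> i = m \<and> j = 0"
    if "i \<le> m" "j \<le> m" "(g (s + i), g (s + j)) \<in> E" for i j s
  proof (cases "i \<le> j")
    case True
    then show ?thesis using g_chord[of "s + i" "s + j"] that n by auto
  next
    case False
    then show ?thesis using g_chord[of "s + i" "s + j + n"] that n g(3)[of "s + j"] by auto
  qed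
  have closing: "g (Suc s + m) = g s" for s using g(3)[of s] n by simp
  have B_covers: "B \<subseteq> cover_arcs B"
  proof (intro subsetI, rule ccontr)
    fix e assume "e \<in> B" "e \<notin> cover_arcs B"
    moreover obtain u v where "e = (u, v)" by (cases e)
    ultimately have uv: "(u, v) \<in> A" "u \<in> U" "v \<in> U" "(u, v) \<in> B O B\<^sup>+"
      by (auto simp: cover_arcs_def B_def)
    have next_vertex: "b = g (Suc i)" if b: "(g i, b) \<in> E" "b \<in> U" for i b
    proof -
      obtain k where "b = g (i + k)" "k \<le> m" using b(2) g_range[of _ i] by (auto simp: U_def)
      then show ?thesis using g_chord[of i "i + k"] b(1) n by auto
    qed
    consider "(u, v) \<in> E" | "(v, u) \<in> E" using uv(1) EA by blast
    then show False
    proof cases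
      \<comment> \<open>The arc is unreversed, so the detour against \<open>E\<close> runs in
        \<open>S\<close>, and closure of \<open>S\<close> would reverse the arc.\<close>
      case 1
      obtain s where s: "u = g s" using uv by (auto simp: U_def)
      then have v: "v = g (Suc s)" using next_vertex 1 uv by auto
      have "(g (Suc s + m), g (Suc s + 0)) \<in> (A \<inter> E\<inverse>)\<^sup>+"
      proof (rule chordless_cycle_detour[where h = "\<lambda>i. g (Suc s + i)" and B = B, OF A EA inj])
        show "(g (Suc s + i), g (Suc s + Suc i)) \<in> E" for i using g(2) by simp
        show "B = Restr A ((\<lambda>i. g (Suc s + i)) ` {..m})" by (simp only: U B_def)
        show "(g (Suc s + m), g (Suc s + 0)) \<in> A" "(g (Suc s + m), g (Suc s + 0)) \<in> B O B\<^sup>+"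
          using uv closing s v by auto
        show "j = Suc i \<or> i = m \<and> j = 0"
          if "i \<le> m" "j \<le> m" "(g (Suc s + i), g (Suc s + j)) \<in> E" for i j
          using chord[OF that] .
      qed
      then have "(u, v) \<in> S" using S(2) uv SE closing s v by (auto simp: path_closed_def)
      then show False using SE 1 by auto
    next
      \<comment> \<open>The arc is reversed. Walking the cycle backwards is a directed cycle of
        \<open>E\<inverse>\<close>, and now the detour runs in \<open>A - S\<close>.\<close>
      case 2
      obtain s where s: "v = g s" using uv by (auto simp: U_def)
      then have v: "u = g (Suc s)" using next_vertex 2 uv by auto
      define h where "h i = g (Suc s + (m - i))" for i
      have hU: "h ` {..m} = U"
      proof -
        have "h ` {..m} = (\<lambda>i. g (Suc s + i)) ` ((\<lambda>i. m - i) ` {..m})"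
          by (simp add: h_def image_image)
        also have "(\<lambda>i. m - i) ` {..m} = {..m}"
          by (auto simp: image_iff) (metis atMost_iff diff_diff_cancel diff_le_self)
        finally show ?thesis by (simp only: U)
      qed
      have "(h m, h 0) \<in> (A \<inter> (E\<inverse>)\<inverse>)\<^sup>+"
      proof (rule chordless_cycle_detour[where B = B, OF A(1)])
        show "E\<inverse> \<union> (E\<inverse>)\<inverse> = A \<union> A\<inverse>" using EA by auto
        show "inj_on h {..m}"
        proof (rule inj_onI)
          fix i j assume "i \<in> {..m}" "j \<in> {..m}" "h i = h j"
          moreover from this have "m - i = m - j"
            using inj_onD[OF inj[of "Suc s"], of "m - i" "m - j"] by (simp add: h_def)
          ultimately show "i = j" by simp
        qed
        show "(h i, h (Suc i)) \<in> E\<inverse>" if "i < m" for i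
          using g(2)[of "Suc s + (m - Suc i)"] that by (simp add: h_def Suc_diff_Suc)
        show "j = Suc i \<or> i = m \<and> j = 0" if "i \<le> m" "j \<le> m" "(h i, h j) \<in> E\<inverse>" for i j
          using chord[of "m - j" "m - i" "Suc s"] that by (auto simp: h_def)
        show "B = Restr A (h ` {..m})" by (simp add: hU B_def)
        show "(h m, h 0) \<in> A" "(h m, h 0) \<in> B O B\<^sup>+"
          using uv closing s v by (auto simp: h_def)
      qed
      then have "(u, v) \<in> A - S" using S(3) uv SE closing s v by (auto simp: path_closed_def h_def)
      then show False using SE 2 by auto
    qed
  qed
  define K where "K = B \<union> B\<inverse> - {(g m, g 0), (g 0, g m)}"
  have g0: "(g m, g 0) \<in> E" using g(2)[of m] g(3)[of 0] n by simp
  \<comment> \<open>The cycle has at least three vertices. This keeps the edge from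
    \<open>g 0\<close> to \<open>g (Suc 0)\<close> distinct from the closing edge that
    \<open>K\<close> removes.\<close>
  have "m \<noteq> 0" using g0 irrE by (metis irreflD)
  moreover have "m \<noteq> 1" using g0 g(2)[of 0] asymE by (metis One_nat_def)
  ultimately have m: "1 < m" by simp
  have "(g i, g (Suc i)) \<in> K" if "i < m" for i
  proof -
    have "g i \<noteq> g m" using g_inj[of i m] that n by auto
    moreover have "g i = g 0 \<Longrightarrow> i = 0" using g_inj[of 0 i] that n by auto
    moreover have "g (Suc 0) \<noteq> g m" using g_inj[of "Suc 0" m] m n by auto
    moreover have "(g i, g (Suc i)) \<in> B \<union> B\<inverse>" using g(2)[of i] EA by (auto simp: B_def U_def)
    ultimately show ?thesis by (auto simp: K_def)
  qed
  then have "j \<le> m \<Longrightarrow> (g 0, g j) \<in> K\<^sup>*" for j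
    by (induction j) (auto intro: rtrancl_into_rtrancl)
  then have K1: "(g 0, g m) \<in> K\<^sup>*" by simp
  moreover have "sym K" by (auto simp: K_def sym_def)
  ultimately have K2: "(g m, g 0) \<in> K\<^sup>*" by (meson sym_rtrancl symD)
  have "cover_arcs B = B" using B_covers by (auto simp: cover_arcs_def)
  then have bf: "bypass_free B" using forest[of U] by (simp add: B_def)
  have "(g m, g 0) \<in> B \<union> B\<inverse>" using g0 EA by (auto simp: B_def U_def)
  then show False using bf K1 K2 by (auto simp: bypass_free_def K_def insert_commute)
qed

section \<open>Joins and meets of acyclic sets of reversals\<close>

lemma acyclic_reversals_iff_path_closed:
  assumes "acyclic A" "\<And>U. bypass_free (cover_arcs (Restr A U))" "S \<subseteq> A"
  shows "S \<in> acyclic_reversals A \<longleftrightarrow> path_closed A S \<and> path_closed A (A - S)"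
proof
  assume "S \<in> acyclic_reversals A"
  then show "path_closed A S \<and> path_closed A (A - S)"
    by (blast intro: acyclic_reversals_path_closed acyclic_reversals_complement)
next
  assume "path_closed A S \<and> path_closed A (A - S)"
  then show "S \<in> acyclic_reversals A"
    using acyclic_reorient_if_path_closed[OF assms] assms(3) by (simp add: acyclic_reversals_def)
qed

text \<open>Any acyclic \<open>K\<close> above \<open>S\<close> and \<open>T\<close> is path closed
  and so contains all arcs spanned by \<open>S \<union> T\<close>. These arcs are closed by
  construction, and their complement is closed because no arc is spanned both inside and
  outside.\<close>

lemma acyclic_reversals_join:
  assumes A: "finite A" "acyclic A" and forest: "\<And>U. bypass_free (cover_arcs (Restr A U))"
    and S: "S \<in> acyclic_reversals A" and T: "T \<in> acyclic_reversals A"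
  shows "\<exists>J \<in> acyclic_reversals A. S \<union> T \<subseteq> J \<and> (\<forall>K \<in> acyclic_reversals A. S \<union> T \<subseteq> K \<longrightarrow> J \<subseteq> K)"
proof (intro bexI conjI ballI impI)
  let ?J = "A \<inter> (S \<union> T)\<^sup>+"
  have SA: "S \<subseteq> A" "T \<subseteq> A" using S T by (auto simp: acyclic_reversals_def)
  show "S \<union> T \<subseteq> ?J" using SA by auto
  show "?J \<in> acyclic_reversals A"
    unfolding acyclic_reversals_iff_path_closed[OF A(2) forest Int_lower1]
  proof
    have "?J\<^sup>+ \<subseteq> ((S \<union> T)\<^sup>+)\<^sup>+" by (intro trancl_mono_subset) auto
    then show "path_closed A ?J" by (auto simp: path_closed_def)
    have "A - ?J = A - (S \<union> T)\<^sup>+" by auto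
    moreover have "path_closed A (A - S)" "path_closed A (A - T)"
      using S T by (blast intro: acyclic_reversals_path_closed acyclic_reversals_complement)+
    then have "A \<inter> (A - (S \<union> T)\<^sup>+)\<^sup>+ \<subseteq> A - (S \<union> T)\<^sup>+"
      using no_path_inside_and_outside[OF A forest SA(1) _ SA(2)] by auto
    ultimately show "path_closed A (A - ?J)" by (simp add: path_closed_def)
  qed
  fix K assume K: "K \<in> acyclic_reversals A" "S \<union> T \<subseteq> K"
  then have "?J \<subseteq> A \<inter> K\<^sup>+" using trancl_mono_subset by blast
  then show "?J \<subseteq> K" using acyclic_reversals_path_closed[OF K(1)] by (auto simp: path_closed_def)
qed

lemma acyclic_reversals_meet:
  assumes A: "finite A" "acyclic A" and forest: "\<And>U. bypass_free (cover_arcs (Restr A U))"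
    and S: "S \<in> acyclic_reversals A" and T: "T \<in> acyclic_reversals A"
  shows "\<exists>M \<in> acyclic_reversals A. M \<subseteq> S \<inter> T \<and> (\<forall>K \<in> acyclic_reversals A. K \<subseteq> S \<inter> T \<longrightarrow> K \<subseteq> M)"
proof -
  obtain J where J: "J \<in> acyclic_reversals A" "(A - S) \<union> (A - T) \<subseteq> J"
    "\<forall>K \<in> acyclic_reversals A. (A - S) \<union> (A - T) \<subseteq> K \<longrightarrow> J \<subseteq> K"
    using acyclic_reversals_join[OF A forest S[THEN acyclic_reversals_complement]
      T[THEN acyclic_reversals_complement]] by auto
  show ?thesis
  proof (intro bexI conjI ballI impI)
    show "A - J \<in> acyclic_reversals A" using J(1) by (rule acyclic_reversals_complement)
    show "A - J \<subseteq> S \<inter> T" using J(2) by auto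
    fix K assume K: "K \<in> acyclic_reversals A" "K \<subseteq> S \<inter> T"
    have "(A - S) \<union> (A - T) \<subseteq> A - K" using K(2) by blast
    then have "J \<subseteq> A - K" using J(3) acyclic_reversals_complement[OF K(1)] by blast
    moreover have "K \<subseteq> A" using K by (simp add: acyclic_reversals_def)
    ultimately show "K \<subseteq> A - J" by auto
  qed
qed


section \<open>Walks and cycles of digraphs\<close>

context wf_digraph
begin

lemma ex_cycle_iff: "(\<exists>p. cycle p) \<longleftrightarrow> \<not> acyclic (arcs_ends G)"
proof
  assume "\<exists>p. cycle p"
  then obtain u p where "awalk u p u" "p \<noteq> []" by (auto simp: cycle_def)
  then have "(u, u) \<in> (arcs_ends G)\<^sup>+" by (rule reachable1_awalkI)
  then show "\<not> acyclic (arcs_ends G)" by (auto simp: acyclic_def)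
next
  assume "\<not> acyclic (arcs_ends G)"
  then obtain u p where "awalk u p u" "p \<noteq> []" by (auto simp: acyclic_def reachable1_awalk)
  then have "closed_w p" by (auto simp: closed_w_def)
  then show "\<exists>p. cycle p" by (rule closed_w_imp_cycle)
qed

lemma acyclic_awalk_imp_apath:
  assumes "acyclic (arcs_ends G)" "awalk u p v"
  shows "apath u p v"
proof (rule ccontr)
  assume "\<not> apath u p v"
  then have "\<not> distinct (awalk_verts u p)" using assms(2) by (simp add: apath_def)
  from awalk_not_distinct_decomp[OF assms(2) this]
  obtain r w where "awalk w r w" "0 < length r" by blast
  then have "closed_w r" by (auto simp: closed_w_def)
  then show False using closed_w_imp_cycle assms(1) ex_cycle_iff by blast
qed

lemma ex_apath_length_ge_2_iff:
  assumes "acyclic (arcs_ends G)"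
  shows "(\<exists>p. apath u p v \<and> 2 \<le> length p) \<longleftrightarrow> (u, v) \<in> arcs_ends G O (arcs_ends G)\<^sup>+"
proof
  assume "\<exists>p. apath u p v \<and> 2 \<le> length p"
  then obtain p where p: "awalk u p v" "2 \<le> length p" by (auto simp: apath_def)
  then obtain e q where "p = e # q" by (cases p) auto
  moreover from this have "q \<noteq> []" using p(2) by auto
  ultimately have q: "p = e # q" "q \<noteq> []" .
  then have "(head G e, v) \<in> (arcs_ends G)\<^sup>+"
    using p by (intro reachable1_awalkI) (auto simp: awalk_Cons_iff)
  moreover have "(u, head G e) \<in> arcs_ends G"
    using p q by (auto simp: awalk_Cons_iff dest: in_arcs_imp_in_arcs_ends)
  ultimately show "(u, v) \<in> arcs_ends G O (arcs_ends G)\<^sup>+" by blast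
next
  assume "(u, v) \<in> arcs_ends G O (arcs_ends G)\<^sup>+"
  then obtain w where w: "(u, w) \<in> arcs_ends G" "(w, v) \<in> (arcs_ends G)\<^sup>+" by blast
  from w(1) obtain e where e: "e \<in> arcs G" "tail G e = u" "head G e = w" by blast
  obtain q where q: "awalk w q v" "q \<noteq> []" using w(2) by (auto simp: reachable1_awalk)
  have "awalk u (e # q) v" using e q by (auto simp: awalk_Cons_iff)
  then show "\<exists>p. apath u p v \<and> 2 \<le> length p"
    using acyclic_awalk_imp_apath[OF assms] q(2) by (intro exI[of _ "e # q"]) (cases q; auto)
qed

lemma arcs_ends_transitive_reduction:
  assumes "acyclic (arcs_ends G)"
  shows "arcs_ends (transitive_reduction G) = cover_arcs (arcs_ends G)"
  unfolding transitive_reduction_def ex_apath_length_ge_2_iff[OF assms] cover_arcs_def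
  by (auto simp: arcs_ends_conv)

lemma wf_digraph_transitive_reduction: "wf_digraph (transitive_reduction G)"
  by unfold_locales (auto simp: transitive_reduction_def)

lemma parcs_mk_symmetric_arcs_ends: "parcs (mk_symmetric G) = arcs_ends G \<union> (arcs_ends G)\<inverse>"
  by (auto simp: parcs_mk_symmetric arcs_ends_conv image_iff)

text \<open>A bypass of an edge can be taken as a simple path and closes up with that edge to an
  undirected cycle.\<close>

lemma underlying_forest_bypass_free:
  assumes forest: "underlying_forest G" and irrefl: "irrefl (arcs_ends G)"
  shows "bypass_free (arcs_ends G)"
  unfolding bypass_free_def
proof (intro ballI, clarify)
  let ?H = "arcs_ends G"
  fix a b
  define K where "K = ?H \<union> ?H\<inverse> - {(a, b), (b, a)}"
  assume ab: "(a, b) \<in> ?H" and bypass: "(a, b) \<in> (?H \<union> ?H\<inverse> - {(a, b), (b, a)})\<^sup>*"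
  have verts: "x \<in> verts G" "y \<in> verts G" if "(x, y) \<in> ?H" for x y
    using that by (auto simp: arcs_ends_conv)
  interpret S: pair_wf_digraph "mk_symmetric G" by (rule wellformed_mk_symmetric)
  interpret K: pair_wf_digraph "\<lparr>pverts = verts G, parcs = K\<rparr>"
    by unfold_locales (use verts in \<open>auto simp: K_def\<close>)
  have "a \<noteq> b" using ab irrefl by (auto simp: irrefl_def)
  have "sym K" by (auto simp: K_def sym_def)
  then have "(b, a) \<in> K\<^sup>*" using bypass by (metis K_def sym_rtrancl symD)
  then have "(b, a) \<in> K\<^sup>+" using \<open>a \<noteq> b\<close> by (metis rtranclD)
  then obtain q where "K.awalk b q a" using K.reachable1_awalk by auto
  then obtain p where p: "K.apath b p a" using K.apath_awalk_to_apath by blast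
  have pK: "set p \<subseteq> K" using p by (auto simp: K.apath_def K.awalk_def)
  have cas: "pcas b p a" using p by (auto simp: K.apath_def K.awalk_def)
  have dist: "distinct (pawalk_verts b p)" using p by (auto simp: K.apath_def)
  have "S.awalk b p a"
    using cas pK verts ab by (auto simp: S.awalk_def parcs_mk_symmetric_arcs_ends K_def)
  then have "S.awalk a ((a, b) # p) a"
    using ab by (auto simp: S.awalk_Cons_iff parcs_mk_symmetric_arcs_ends)
  then have "S.cycle ((a, b) # p)"
    using dist by (auto simp: S.cycle_def)
  \<comment> \<open>A path with a single arc would be \<open>(b, a)\<close>, which \<open>K\<close>
    lacks; so the cycle has length at least 3.\<close>
  moreover have "2 \<le> length p"
  proof (cases p)
    case Nil
    then show ?thesis using cas \<open>a \<noteq> b\<close> by simp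
  next
    case (Cons e q)
    then show ?thesis using cas pK by (cases q) (auto simp: K_def)
  qed
  ultimately show False using forest by (auto simp: underlying_forest_def)
qed

end

lemma pcas_nth:
  assumes "pcas u p v" "i < length p"
  shows "fst (p ! i) = (if i = 0 then u else snd (p ! (i - 1)))"
    and "Suc i = length p \<Longrightarrow> snd (p ! i) = v"
  using assms by (induction p arbitrary: u i) (auto simp: nth_Cons split: nat.splits)

context wf_digraph
begin

text \<open>An undirected cycle of length at least 3 uses no edge in both directions, so its arc set
  is an admissible \<open>C\<close> that is not acyclic.\<close>

lemma underlying_forest_if_acyclic_subsets:
  assumes "\<And>C. C \<subseteq> arcs_ends G \<union> (arcs_ends G)\<inverse> \<Longrightarrow> C \<inter> C\<inverse> = {} \<Longrightarrow> acyclic C"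
  shows "underlying_forest G"
  unfolding underlying_forest_def
proof (intro notI, elim exE conjE)
  interpret S: pair_wf_digraph "mk_symmetric G" by (rule wellformed_mk_symmetric)
  fix p assume cyc: "S.cycle p" and len: "3 \<le> length p"
  then obtain u where u: "S.awalk u p u" "distinct (tl (pawalk_verts u p))"
    by (auto simp: S.cycle_def)
  then have cas: "pcas u p u" and sub: "set p \<subseteq> arcs_ends G \<union> (arcs_ends G)\<inverse>"
    by (auto simp: S.awalk_def parcs_mk_symmetric_arcs_ends)
  have "p \<noteq> []" using len by auto
  then have "distinct (map snd p)" using u(2) S.awalk_verts_conv'[of u p u] cas by auto
  then have inj: "i = j" if "i < length p" "j < length p" "snd (p ! i) = snd (p ! j)" for i j
    using that by (metis distinct_conv_nth length_map nth_map)
  \<comment> \<open>The heads of the arcs are distinct, so the arc before \<open>p ! j\<close> is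
    determined, cyclically. Two opposite arcs would each precede the other, which bounds the length
    by 2.\<close>
  have pred: "i = (if j = 0 then length p - 1 else j - 1)"
    if "i < length p" "j < length p" "snd (p ! i) = fst (p ! j)" for i j
  proof -
    have "fst (p ! j) = snd (p ! (if j = 0 then length p - 1 else j - 1))"
      using pcas_nth[OF cas, of j] pcas_nth(2)[OF cas, of "length p - 1"] that by auto
    then show ?thesis using inj[of i "if j = 0 then length p - 1 else j - 1"] that by auto
  qed
  have "set p \<inter> (set p)\<inverse> = {}"
  proof (rule ccontr)
    assume "set p \<inter> (set p)\<inverse> \<noteq> {}"
    then obtain x y where "(x, y) \<in> set p" "(y, x) \<in> set p" by auto
    then obtain i j where "i < length p" "j < length p" "p ! i = (x, y)" "p ! j = (y, x)"
      by (metis in_set_conv_nth)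
    then have "i < length p" "j < length p"
      "i = (if j = 0 then length p - 1 else j - 1)" "j = (if i = 0 then length p - 1 else i - 1)"
      using pred[of i j] pred[of j i] by auto
    then show False using len by presburger
  qed
  then have "acyclic (set p)" using assms sub by blast
  interpret P: pair_wf_digraph "\<lparr>pverts = verts G, parcs = set p\<rparr>"
    by unfold_locales (use sub in \<open>auto simp: arcs_ends_conv\<close>)
  have "P.awalk u p u" using u(1) by (auto simp: P.awalk_def S.awalk_def)
  then have "(u, u) \<in> (set p)\<^sup>+" using P.reachable1_awalkI[OF _ \<open>p \<noteq> []\<close>] by simp
  then show False using \<open>acyclic (set p)\<close> by (auto simp: acyclic_def)
qed

end


section \<open>The poset of acyclic reorientations\<close>

context simple_dag
begin

lemma acyclic_arcs: "acyclic (parcs D)"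
  using no_cycle ex_cycle_iff by simp

lemma reorientation_iff:
  "reorientation D E \<longleftrightarrow> pverts E = pverts D \<and>
    parcs E \<union> (parcs E)\<inverse> = parcs D \<union> (parcs D)\<inverse> \<and> asym (parcs E)"
proof -
  have "mk_symmetric (with_proj F) = \<lparr>pverts = pverts F, parcs = parcs F \<union> (parcs F)\<inverse>\<rparr>"
    for F :: "'a pair_pre_digraph"
    by (auto simp: mk_symmetric_def)
  then show ?thesis by (auto simp: reorientation_def)
qed

lemma reorientation_parcs:
  assumes "reorientation D E"
  shows "parcs E = reorient (parcs D) (reversed_arcs D E)"
proof -
  have "parcs E \<union> (parcs E)\<inverse> = parcs D \<union> (parcs D)\<inverse>" "asym (parcs E)"
    using assms by (auto simp: reorientation_iff)
  then show ?thesis by (fastforce simp: reorient_def reversed_arcs_def dest: asymD)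
qed

text \<open>\<open>E\<close> is an arbitrary record at first; that its arcs join its vertices
  follows from sharing the edges of \<open>D\<close>.\<close>

lemma reorientation_ex_cycle_iff:
  assumes "reorientation D E"
  shows "(\<exists>p. pre_digraph.cycle (with_proj E) p) \<longleftrightarrow> \<not> acyclic (parcs E)"
proof -
  have "parcs E \<subseteq> parcs D \<union> (parcs D)\<inverse>" using assms by (auto simp: reorientation_iff)
  moreover have "parcs D \<subseteq> pverts D \<times> pverts D" by (auto dest: in_arcsD1 in_arcsD2)
  ultimately have "parcs E \<subseteq> pverts E \<times> pverts E" using assms by (auto simp: reorientation_iff)
  then interpret E: pair_wf_digraph E by unfold_locales auto
  show ?thesis using E.ex_cycle_iff by simp
qed

lemma carrier_iff:
  "E \<in> carrier (acyclic_reorientation_poset D) \<longleftrightarrow> reorientation D E \<and> acyclic (parcs E)"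
  using reorientation_ex_cycle_iff by (auto simp: acyclic_reorientation_poset_def)

lemma le_iff: "E \<sqsubseteq>\<^bsub>acyclic_reorientation_poset D\<^esub> F \<longleftrightarrow> reversed_arcs D E \<subseteq> reversed_arcs D F"
  by (simp add: acyclic_reorientation_poset_def)

lemma reversed_arcs_acyclic_reversals:
  assumes "E \<in> carrier (acyclic_reorientation_poset D)"
  shows "reversed_arcs D E \<in> acyclic_reversals (parcs D)"
  using assms reorientation_parcs
  by (auto simp: carrier_iff acyclic_reversals_def reversed_arcs_def)

text \<open>This equality turns quantifiers over the carrier into quantifiers over acyclic sets of
  reversals.\<close>

lemma image_reversed_arcs:
  "reversed_arcs D ` carrier (acyclic_reorientation_poset D) = acyclic_reversals (parcs D)"
proof
  show "reversed_arcs D ` carrier (acyclic_reorientation_poset D) \<subseteq> acyclic_reversals (parcs D)"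
    using reversed_arcs_acyclic_reversals by blast
  show "acyclic_reversals (parcs D) \<subseteq> reversed_arcs D ` carrier (acyclic_reorientation_poset D)"
  proof
    fix S assume "S \<in> acyclic_reversals (parcs D)"
    then have S: "S \<subseteq> parcs D" "acyclic (reorient (parcs D) S)"
      by (auto simp: acyclic_reversals_def)
    let ?E = "\<lparr>pverts = pverts D, parcs = reorient (parcs D) S\<rparr>"
    have "asym (reorient (parcs D) S)" using acyclic_asymD[OF S(2)] by (blast intro: asymI)
    then have "?E \<in> carrier (acyclic_reorientation_poset D)"
      using S by (auto simp: carrier_iff reorientation_iff reorient_def)
    moreover have "reversed_arcs D ?E = S"
      using S(1) asym_arcs by (auto simp: reversed_arcs_def reorient_def dest: asymD)
    ultimately show "S \<in> reversed_arcs D ` carrier (acyclic_reorientation_poset D)" by blast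
  qed
qed

lemma least_Upper_iff:
  assumes "E \<in> carrier (acyclic_reorientation_poset D)" "F \<in> carrier (acyclic_reorientation_poset D)"
  shows "(\<exists>s. least (acyclic_reorientation_poset D) s (Upper (acyclic_reorientation_poset D) {E, F})) \<longleftrightarrow>
    (\<exists>J \<in> acyclic_reversals (parcs D). reversed_arcs D E \<union> reversed_arcs D F \<subseteq> J \<and>
      (\<forall>K \<in> acyclic_reversals (parcs D). reversed_arcs D E \<union> reversed_arcs D F \<subseteq> K \<longrightarrow> J \<subseteq> K))"
proof -
  let ?L = "acyclic_reorientation_poset D" and ?R = "reversed_arcs D"
  have U: "Upper ?L {E, F} = {t \<in> carrier ?L. ?R E \<union> ?R F \<subseteq> ?R t}"
    using assms unfolding Upper_def by (auto simp: le_iff)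
  have "(\<exists>s. least ?L s (Upper ?L {E, F})) \<longleftrightarrow>
      (\<exists>s \<in> carrier ?L. ?R E \<union> ?R F \<subseteq> ?R s \<and> (\<forall>t \<in> carrier ?L. ?R E \<union> ?R F \<subseteq> ?R t \<longrightarrow> ?R s \<subseteq> ?R t))"
    unfolding least_def le_iff U by blast
  then show ?thesis unfolding image_reversed_arcs[symmetric] ball_simps bex_simps .
qed

lemma greatest_Lower_iff:
  assumes "E \<in> carrier (acyclic_reorientation_poset D)" "F \<in> carrier (acyclic_reorientation_poset D)"
  shows "(\<exists>s. greatest (acyclic_reorientation_poset D) s (Lower (acyclic_reorientation_poset D) {E, F})) \<longleftrightarrow>
    (\<exists>M \<in> acyclic_reversals (parcs D). M \<subseteq> reversed_arcs D E \<inter> reversed_arcs D F \<and>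
      (\<forall>K \<in> acyclic_reversals (parcs D). K \<subseteq> reversed_arcs D E \<inter> reversed_arcs D F \<longrightarrow> K \<subseteq> M))"
proof -
  let ?L = "acyclic_reorientation_poset D" and ?R = "reversed_arcs D"
  have U: "Lower ?L {E, F} = {t \<in> carrier ?L. ?R t \<subseteq> ?R E \<inter> ?R F}"
    using assms unfolding Lower_def by (auto simp: le_iff)
  have "(\<exists>s. greatest ?L s (Lower ?L {E, F})) \<longleftrightarrow>
      (\<exists>s \<in> carrier ?L. ?R s \<subseteq> ?R E \<inter> ?R F \<and> (\<forall>t \<in> carrier ?L. ?R t \<subseteq> ?R E \<inter> ?R F \<longrightarrow> ?R t \<subseteq> ?R s))"
    unfolding greatest_def le_iff U by blast
  then show ?thesis unfolding image_reversed_arcs[symmetric] ball_simps bex_simps .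
qed

section \<open>Induced subgraphs and the two implications\<close>

lemma arcs_ends_induced: "arcs_ends (with_proj D \<restriction> U) = Restr (parcs D) U"
  by (auto simp: arcs_ends_conv image_iff)

lemma acyclic_Restr: "acyclic (Restr (parcs D) U)"
  using acyclic_arcs by (rule acyclic_subset) blast

lemma arcs_ends_reduction:
  "arcs_ends (transitive_reduction (with_proj D \<restriction> U)) = cover_arcs (Restr (parcs D) U)"
  using wf_digraph.arcs_ends_transitive_reduction[OF wellformed_induce_subgraph] acyclic_Restr
  by (simp add: arcs_ends_induced)

lemma wf_digraph_reduction: "wf_digraph (transitive_reduction (with_proj D \<restriction> U))"
  using wf_digraph.wf_digraph_transitive_reduction[OF wellformed_induce_subgraph] .

lemma vertebrate_bypass_free:
  assumes "vertebrate D"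
  shows "bypass_free (cover_arcs (Restr (parcs D) U))"
proof -
  \<comment> \<open>\<open>vertebrate\<close> speaks of sets of vertices only, whereas
    \<open>U\<close> is arbitrary here.\<close>
  let ?W = "U \<inter> pverts D"
  have "Restr (parcs D) U = Restr (parcs D) ?W" by (auto dest: in_arcsD1 in_arcsD2)
  moreover have "underlying_forest (transitive_reduction (with_proj D \<restriction> ?W))"
    using assms by (simp add: vertebrate_def)
  moreover have "irrefl (cover_arcs (Restr (parcs D) ?W))"
    using acyclic_irreflD[OF acyclic_Restr] by (auto simp: irrefl_def cover_arcs_def)
  ultimately show ?thesis
    using wf_digraph.underlying_forest_bypass_free[OF wf_digraph_reduction, of ?W]
    by (simp add: arcs_ends_reduction)
qed

lemma lattice_if_vertebrate:
  assumes "vertebrate D"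
  shows "lattice (acyclic_reorientation_poset D)"
proof -
  interpret partial_order "acyclic_reorientation_poset D"
    by (rule partial_order_acyclic_reorientation_poset)
  note forest = vertebrate_bypass_free[OF assms]
  show ?thesis
  proof unfold_locales
    fix E F
    assume EF: "E \<in> carrier (acyclic_reorientation_poset D)" "F \<in> carrier (acyclic_reorientation_poset D)"
    note S = EF[THEN reversed_arcs_acyclic_reversals]
    show "\<exists>s. least (acyclic_reorientation_poset D) s (Upper (acyclic_reorientation_poset D) {E, F})"
      unfolding least_Upper_iff[OF EF] by (rule acyclic_reversals_join[OF pair_finite_arcs acyclic_arcs forest S])
    show "\<exists>s. greatest (acyclic_reorientation_poset D) s (Lower (acyclic_reorientation_poset D) {E, F})"
      unfolding greatest_Lower_iff[OF EF] by (rule acyclic_reversals_meet[OF pair_finite_arcs acyclic_arcs forest S])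
  qed
qed

lemma vertebrate_if_lattice:
  assumes "lattice (acyclic_reorientation_poset D)"
  shows "vertebrate D"
  unfolding vertebrate_def
proof (intro allI impI)
  interpret lattice "acyclic_reorientation_poset D" by fact
  fix U
  have joins: "\<exists>J \<in> acyclic_reversals (parcs D). S \<union> T \<subseteq> J \<and>
      (\<forall>K \<in> acyclic_reversals (parcs D). S \<union> T \<subseteq> K \<longrightarrow> J \<subseteq> K)"
    if "S \<in> acyclic_reversals (parcs D)" "T \<in> acyclic_reversals (parcs D)" for S T
  proof -
    obtain E F where EF: "E \<in> carrier (acyclic_reorientation_poset D)"
      "F \<in> carrier (acyclic_reorientation_poset D)" "S = reversed_arcs D E" "T = reversed_arcs D F"
      using \<open>S \<in> _\<close> \<open>T \<in> _\<close> unfolding image_reversed_arcs[symmetric] by blast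
    show ?thesis using sup_of_two_exists[OF EF(1,2)] unfolding least_Upper_iff[OF EF(1,2)] EF(3,4) .
  qed
  show "underlying_forest (transitive_reduction (with_proj D \<restriction> U))"
    using cyclic_cover_arcs_no_joins[OF acyclic_arcs pair_finite_arcs joins]
    by (intro wf_digraph.underlying_forest_if_acyclic_subsets[OF wf_digraph_reduction])
      (simp add: arcs_ends_reduction)
qed

end

theorem theorem1:
  fixes D :: "'a pair_pre_digraph"
  assumes "simple_dag D"
  shows "lattice (acyclic_reorientation_poset D) \<longleftrightarrow> vertebrate D"
  using assms simple_dag.lattice_if_vertebrate simple_dag.vertebrate_if_lattice by blast

end
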